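(* Let $n\ge1$ and let $\nu$ be the Borel measure on $X=\mathrm{Spec}\,\mathrm{Free}_n(\mathcal V)$ defined by $\nu(A)=\eta(\rho^{-1}[A])$, where $\eta$ is the normalized (probability) $(n-1)$-dimensional Lebesgue measure on $\Delta^{n-1}$. Then $\nu=\lambda$.
   Context: $\mathcal V$ is the variety generated by $M=((0,1],\star,\to,1)$, $\star$ the product of reals, $a\to b=\min\{1,b/a\}$. $\mathrm{Free}_n(\mathcal V)$ is the algebra of functions $(0,1]^n\to(0,1]$ generated by the coordinate projections under pointwise operations. A filter is the preimage of $1$ under a homomorphism; $X$ is the set of proper prime filters, topologized by the subbasis $O_a=\{\mathfrak p:a\notin\mathfrak p\}$. $\pi(p)=\{t:t(p)=1\}$ for $p\in(0,1]^n\setminus\{(1,\dots,1)\}$, and $\lambda(A)=\mathrm{Leb}(\pi^{-1}[A])$ with Leb the Lebesgue measure on $(0,1]^n$. $\Delta^{n-1}=\{u\in(-\infty,0]^n:\sum_iu_i=-1\}$, and $\rho:\Delta^{n-1}\to X$, $\rho(u)=\{t\in\mathrm{Free}_n(\mathcal V):t(\exp u)=1\}$ with $\exp$ applied componentwise; $\rho$ is a homeomorphism onto the set of maximal elements of $X$. *)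

theory Defs
  imports "HOL-Analysis.Analysis"
begin

section \<open>Algebras of type \<open>(\<star>, \<rightarrow>, 1)\<close> and the variety generated by \<open>(0,1]\<close>\<close>

record 'a alg =
  univ :: "'a set"
  mul :: "'a \<Rightarrow> 'a \<Rightarrow> 'a"
  imp :: "'a \<Rightarrow> 'a \<Rightarrow> 'a"
  unit :: 'a

definition is_alg :: "'a alg \<Rightarrow> bool" where
  "is_alg A \<longleftrightarrow> unit A \<in> univ A \<and>
     (\<forall>a\<in>univ A. \<forall>b\<in>univ A. mul A a b \<in> univ A \<and> imp A a b \<in> univ A)"

datatype trm = Var nat | Unit | Mul trm trm | Imp trm trm

primrec eval :: "'a alg \<Rightarrow> (nat \<Rightarrow> 'a) \<Rightarrow> trm \<Rightarrow> 'a" where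
  "eval A v (Var k) = v k"
| "eval A v Unit = unit A"
| "eval A v (Mul s t) = mul A (eval A v s) (eval A v t)"
| "eval A v (Imp s t) = imp A (eval A v s) (eval A v t)"

definition satisfies :: "'a alg \<Rightarrow> trm \<Rightarrow> trm \<Rightarrow> bool" where
  "satisfies A s t \<longleftrightarrow> (\<forall>v. range v \<subseteq> univ A \<longrightarrow> eval A v s = eval A v t)"

definition M :: "real alg" where
  "M = \<lparr>univ = {0<..1}, mul = (\<lambda>a b. a * b), imp = (\<lambda>a b. min 1 (b / a)), unit = 1\<rparr>"

text \<open>The variety generated by \<open>M\<close> is the smallest equational class containing \<open>M\<close>, that is,
  the class of all models of the identities of \<open>M\<close>.\<close>

definition in_variety :: "'a alg \<Rightarrow> bool" where
  "in_variety A \<longleftrightarrow> is_alg A \<and> (\<forall>s t. satisfies M s t \<longrightarrow> satisfies A s t)"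

definition is_hom :: "'a alg \<Rightarrow> 'b alg \<Rightarrow> ('a \<Rightarrow> 'b) \<Rightarrow> bool" where
  "is_hom A B h \<longleftrightarrow> h \<in> univ A \<rightarrow> univ B \<and> h (unit A) = unit B \<and>
     (\<forall>a\<in>univ A. \<forall>b\<in>univ A.
        h (mul A a b) = mul B (h a) (h b) \<and> h (imp A a b) = imp B (h a) (h b))"


section \<open>Free algebras\<close>

text \<open>Functions on \<open>S\<close> are represented extensionally, with the value \<open>undefined\<close> off \<open>S\<close>.\<close>

definition power_alg :: "'a alg \<Rightarrow> 's set \<Rightarrow> ('s \<Rightarrow> 'a) alg" where
  "power_alg A S =
     \<lparr>univ = (S \<rightarrow>\<^sub>E univ A),
      mul = (\<lambda>f g. \<lambda>x\<in>S. mul A (f x) (g x)),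
      imp = (\<lambda>f g. \<lambda>x\<in>S. imp A (f x) (g x)),
      unit = (\<lambda>x\<in>S. unit A)\<rparr>"

inductive_set generated :: "'a alg \<Rightarrow> 'a set \<Rightarrow> 'a set" for A G where
  gen: "a \<in> G \<Longrightarrow> a \<in> generated A G"
| unit: "unit A \<in> generated A G"
| mul: "a \<in> generated A G \<Longrightarrow> b \<in> generated A G \<Longrightarrow> mul A a b \<in> generated A G"
| imp: "a \<in> generated A G \<Longrightarrow> b \<in> generated A G \<Longrightarrow> imp A a b \<in> generated A G"

definition cube :: "(real^'n) set" where
  "cube = {p. \<forall>i. 0 < p $ i \<and> p $ i \<le> 1}"

definition Free :: "(real^'n \<Rightarrow> real) alg" where
  "Free = (power_alg M cube)
     \<lparr>univ := generated (power_alg M cube) (range (\<lambda>i. \<lambda>p\<in>cube. p $ i))\<rparr>"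


section \<open>The prime spectrum\<close>

text \<open>Up to isomorphism, the image of a homomorphism out of \<open>A\<close> is a quotient of \<open>A\<close>, whose
  elements are congruence classes, that is, subsets of \<open>univ A\<close>. Admitting only codomains over
  the type \<open>'a set\<close> is therefore no restriction.\<close>

definition is_filter :: "'a alg \<Rightarrow> 'a set \<Rightarrow> bool" where
  "is_filter A F \<longleftrightarrow>
     (\<exists>(B :: 'a set alg) h. in_variety B \<and> is_hom A B h \<and> F = {a \<in> univ A. h a = unit B})"

text \<open>The join of the natural lattice order \<open>a \<le> b \<longleftrightarrow> a \<rightarrow> b = 1\<close>.
  In \<open>M\<close> it is the maximum of reals, see \<open>join_M\<close>.\<close>

definition join :: "'a alg \<Rightarrow> 'a \<Rightarrow> 'a \<Rightarrow> 'a" where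
  "join A a b = imp A (imp A a b) b"

definition is_prime :: "'a alg \<Rightarrow> 'a set \<Rightarrow> bool" where
  "is_prime A F \<longleftrightarrow>
     is_filter A F \<and> (\<forall>a\<in>univ A. \<forall>b\<in>univ A. join A a b \<in> F \<longrightarrow> a \<in> F \<or> b \<in> F)"

definition Spec :: "'a alg \<Rightarrow> 'a set set" where
  "Spec A = {F. is_prime A F \<and> F \<noteq> univ A}"

definition spec_topology :: "'a alg \<Rightarrow> 'a set topology" where
  "spec_topology A = topology_generated_by ((\<lambda>a. {F \<in> Spec A. a \<notin> F}) ` univ A)"

definition spec_borel :: "'a alg \<Rightarrow> 'a set measure" where
  "spec_borel A = sigma (Spec A) {U. openin (spec_topology A) U}"


section \<open>The measures\<close>

definition point_filter :: "real^'n \<Rightarrow> (real^'n \<Rightarrow> real) set" where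
  "point_filter p = {t \<in> univ Free. t p = 1}"

definition lambda_measure :: "(real^'n \<Rightarrow> real) set measure" where
  "lambda_measure = distr (lebesgue_on (cube - {\<chi> i. 1})) (spec_borel Free) point_filter"

definition Delta :: "(real^'n) set" where
  "Delta = {u. (\<forall>i. u $ i \<le> 0) \<and> (\<Sum>i\<in>UNIV. u $ i) = -1}"

definition rho :: "real^'n \<Rightarrow> (real^'n \<Rightarrow> real) set" where
  "rho u = {t \<in> univ Free. t (\<chi> i. exp (u $ i)) = 1}"

definition orthonormal_basis_of :: "'a::euclidean_space set \<Rightarrow> 'a set" where
  "orthonormal_basis_of S =
     (SOME B. pairwise orthogonal B \<and> (\<forall>b\<in>B. norm b = 1) \<and> span B = S)"

text \<open>The \<open>dim S\<close>-dimensional Lebesgue measure on the affine subspace \<open>a + S\<close>, as a measure on the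
  ambient space: product Lebesgue measure in isometric coordinates.
  It does not depend on the orthonormal basis chosen, nor on the choice of \<open>a\<close> in \<open>a + S\<close>.
  For \<open>S = {0}\<close> it is the unit point mass at \<open>a\<close>.\<close>

definition affine_lborel :: "'a::euclidean_space \<Rightarrow> 'a set \<Rightarrow> 'a measure" where
  "affine_lborel a S =
     (let B = orthonormal_basis_of S
      in distr (\<Pi>\<^sub>M b\<in>B. lborel) borel (\<lambda>c. a + (\<Sum>b\<in>B. c b *\<^sub>R b)))"

text \<open>The base point \<open>(-1/n, \<dots>, -1/n)\<close> lies in the affine hull of \<open>Delta\<close>.\<close>

definition eta :: "(real^'n) measure" where
  "eta = restrict_space
     (uniform_measure
        (affine_lborel (\<chi> i. - 1 / real CARD('n)) {v. (\<Sum>i\<in>UNIV. v $ i) = 0}) Delta)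
     Delta"

definition nu_measure :: "(real^'n \<Rightarrow> real) set measure" where
  "nu_measure = distr eta (spec_borel Free) rho"


section \<open>Well-definedness\<close>

lemma join_M: "a \<in> univ M \<Longrightarrow> b \<in> univ M \<Longrightarrow> join M a b = max a b"
  by (auto simp: join_def M_def min_def max_def field_simps)

lemma topspace_spec_topology: "topspace (spec_topology A) = Spec A"
proof -
  have "\<exists>a\<in>univ A. a \<notin> F" if "F \<in> Spec A" for F
  proof -
    have "F \<subseteq> univ A" "F \<noteq> univ A"
      using that by (auto simp: Spec_def is_prime_def is_filter_def)
    then show ?thesis by blast
  qed
  then show ?thesis
    by (auto simp: spec_topology_def topology_generated_by_topspace)
qed

lemma space_spec_borel: "space (spec_borel A) = Spec A"
  and sets_spec_borel: "sets (spec_borel A) = sigma_sets (Spec A) {U. openin (spec_topology A) U}"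
proof -
  have "{U. openin (spec_topology A) U} \<subseteq> Pow (Spec A)"
    using openin_subset[of "spec_topology A"] by (auto simp: topspace_spec_topology)
  then show "space (spec_borel A) = Spec A"
    "sets (spec_borel A) = sigma_sets (Spec A) {U. openin (spec_topology A) U}"
    by (simp_all add: spec_borel_def)
qed

lemma Free_ops:
  "unit (Free :: (real^'n \<Rightarrow> real) alg) = (\<lambda>p\<in>cube. 1)"
  "mul (Free :: (real^'n \<Rightarrow> real) alg) = (\<lambda>f g. \<lambda>p\<in>cube. f p * g p)"
  "imp (Free :: (real^'n \<Rightarrow> real) alg) = (\<lambda>f g. \<lambda>p\<in>cube. min 1 (g p / f p))"
  by (simp_all add: Free_def power_alg_def M_def)

lemma Free_continuous_range:
  assumes "t \<in> univ (Free :: (real^'n \<Rightarrow> real) alg)"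
  shows "continuous_on cube t \<and> t \<in> cube \<rightarrow> {0<..1}"
proof -
  have "t \<in> generated (power_alg M cube) (range (\<lambda>i. \<lambda>p\<in>cube. p $ i))"
    using assms by (simp add: Free_def)
  then show ?thesis
  proof induction
    case (gen a)
    then obtain i where a: "a = (\<lambda>p\<in>cube. p $ i)" by blast
    have "continuous_on cube (\<lambda>p::real^'n. p $ i)" by (intro continuous_intros)
    then have "continuous_on cube a"
      unfolding a by (rule continuous_on_cong[THEN iffD1, rotated -1]) auto
    then show ?case by (auto simp: a cube_def)
  next
    case unit
    have "continuous_on cube (\<lambda>p::real^'n. 1::real)" by (intro continuous_intros)
    then have "continuous_on cube (\<lambda>p\<in>(cube :: (real^'n) set). 1::real)"
      by (rule continuous_on_cong[THEN iffD1, rotated -1]) auto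
    then show ?case by (auto simp: power_alg_def M_def)
  next
    case (mul a b)
    have "continuous_on cube (\<lambda>p. a p * b p)" using mul by (intro continuous_intros) auto
    then have "continuous_on cube (\<lambda>p\<in>cube. a p * b p)"
      by (rule continuous_on_cong[THEN iffD1, rotated -1]) auto
    moreover have "0 < a p * b p \<and> a p * b p \<le> 1" if "p \<in> cube" for p
    proof -
      have "0 < a p" "a p \<le> 1" "0 < b p" "b p \<le> 1" using mul that by (auto simp: Pi_iff)
      then show ?thesis by (simp add: mult_le_one)
    qed
    ultimately show ?case by (auto simp: power_alg_def M_def)
  next
    case (imp a b)
    have pos: "0 < a p" "0 < b p" if "p \<in> cube" for p using imp that by (auto simp: Pi_iff)
    have "continuous_on cube (\<lambda>p. min 1 (b p / a p))"
      using imp pos by (intro continuous_intros) (auto simp: less_imp_neq[symmetric])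
    then have "continuous_on cube (\<lambda>p\<in>cube. min 1 (b p / a p))"
      by (rule continuous_on_cong[THEN iffD1, rotated -1]) auto
    then show ?case using pos by (auto simp: power_alg_def M_def)
  qed
qed

lemma M_ops: "univ M = {0<..1}" "mul M = (\<lambda>a b. a * b)" "imp M = (\<lambda>a b. min 1 (b / a))" "unit M = 1"
  by (simp_all add: M_def)

lemma point_filter_in_Spec:
  fixes p :: "real^'n"
  assumes p: "p \<in> cube - {\<chi> i. 1}"
  shows "point_filter p \<in> Spec Free"
proof -
  have rng: "0 < t p \<and> t p \<le> 1" if "t \<in> univ (Free :: (real^'n \<Rightarrow> real) alg)" for t
    using Free_continuous_range[OF that] p by (auto simp: Pi_iff)
  define e :: "real \<Rightarrow> (real^'n \<Rightarrow> real) set" where "e = (\<lambda>r. {\<lambda>_. r})"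
  define d where "d = inv e"
  have inj: "inj e" by (auto simp: inj_def e_def dest: fun_cong)
  have de: "d (e r) = r" for r using inj by (simp add: d_def)
  define B where "B = \<lparr>univ = e ` univ M, mul = (\<lambda>a b. e (mul M (d a) (d b))),
    imp = (\<lambda>a b. e (imp M (d a) (d b))), unit = e (unit M)\<rparr>"
  have ev: "eval B (\<lambda>k. e (v k)) s = e (eval M v s)" for v s
    by (induction s) (simp_all add: B_def de)
  have M: "is_alg M" by (auto simp: is_alg_def M_def mult_le_one)
  have "is_alg B" using M by (auto simp: is_alg_def B_def de)
  moreover have "satisfies B s t" if st: "satisfies M s t" for s t
    unfolding satisfies_def
  proof (intro allI impI)
    fix w :: "nat \<Rightarrow> (real^'n \<Rightarrow> real) set"
    assume "range w \<subseteq> univ B"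
    then have w: "w k \<in> e ` univ M" for k by (auto simp: B_def)
    have wk: "e (d (w k)) = w k \<and> d (w k) \<in> univ M" for k :: nat
      using w[of k] de by auto
    define v where "v = (\<lambda>k. d (w k))"
    have w_eq: "(\<lambda>k. e (v k)) = w" and "range v \<subseteq> univ M"
      using wk by (auto simp: v_def)
    then have "eval M v s = eval M v t"
      using st by (auto simp: satisfies_def)
    then show "eval B w s = eval B w t" by (simp only: w_eq[symmetric] ev)
  qed
  ultimately have "in_variety B" by (auto simp: in_variety_def)
  moreover have "is_hom Free B (\<lambda>t. e (t p))"
    using p rng by (auto simp: is_hom_def B_def Free_ops M_ops de)
  moreover have "point_filter p = {t \<in> univ Free. e (t p) = unit B}"
    using inj by (auto simp: point_filter_def B_def M_ops inj_def)
  ultimately have "is_filter Free (point_filter p)" unfolding is_filter_def by blast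
  moreover have "a \<in> point_filter p \<or> b \<in> point_filter p"
    if "a \<in> univ Free" "b \<in> univ Free" "join Free a b \<in> point_filter p" for a b
  proof -
    have "join Free a b p = join M (a p) (b p)" using p by (simp add: join_def Free_ops M_ops)
    also have "\<dots> = max (a p) (b p)" using rng that by (intro join_M) (auto simp: M_ops)
    finally show ?thesis using that by (auto simp: point_filter_def max_def split: if_splits)
  qed
  moreover have "point_filter p \<noteq> univ Free"
  proof
    assume eq: "point_filter p = univ Free"
    have "p $ i = 1" for i
    proof -
      have "(\<lambda>p\<in>cube. p $ i) \<in> univ (Free :: (real^'n \<Rightarrow> real) alg)"
        by (auto simp: Free_def intro: generated.gen)
      then have "(\<lambda>p\<in>cube. p $ i) \<in> point_filter p" using eq by simp
      then show ?thesis using p by (simp add: point_filter_def)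
    qed
    then show False using p by (auto simp: vec_eq_iff)
  qed
  ultimately show ?thesis by (auto simp: Spec_def is_prime_def)
qed

lemma continuous_map_point_filter:
  "continuous_map (top_of_set (cube - {\<chi> i. 1})) (spec_topology Free)
     (point_filter :: real^'n \<Rightarrow> _)"
  unfolding spec_topology_def
proof (intro continuous_on_generated_topo)
  fix U :: "(real^'n \<Rightarrow> real) set set"
  assume "U \<in> (\<lambda>a. {F \<in> Spec Free. a \<notin> F}) ` univ Free"
  then obtain a where a: "a \<in> univ Free" and U: "U = {F \<in> Spec Free. a \<notin> F}" by blast
  let ?S = "cube - {\<chi> i. 1} :: (real^'n) set"
  have "point_filter -` U \<inter> ?S = ?S \<inter> a -` (- {1})"
    using point_filter_in_Spec a by (auto simp: U) (auto simp: point_filter_def)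
  moreover have "continuous_on ?S a"
    using Free_continuous_range[OF a] continuous_on_subset by blast
  ultimately show "openin (top_of_set ?S) (point_filter -` U \<inter> topspace (top_of_set ?S))"
    by (simp add: continuous_openin_preimage_gen open_Compl)
next
  show "point_filter ` topspace (top_of_set (cube - {\<chi> i. 1})) \<subseteq>
      \<Union> ((\<lambda>a. {F \<in> Spec (Free :: (real^'n \<Rightarrow> real) alg). a \<notin> F}) ` univ Free)"
    using point_filter_in_Spec topspace_spec_topology[of "Free :: (real^'n \<Rightarrow> real) alg"]
    by (auto simp: spec_topology_def)
qed

lemma cube_borel: "(cube :: (real^'n) set) \<in> sets borel"
  unfolding cube_def by measurable

lemma Delta_borel: "(Delta :: (real^'n) set) \<in> sets borel"
  unfolding Delta_def by measurable

lemma measurable_spec_borel: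
  assumes "continuous_map (top_of_set S) (spec_topology A) f"
    and "space N = S"
    and "\<And>T. open T \<Longrightarrow> S \<inter> T \<in> sets N"
  shows "f \<in> measurable N (spec_borel A)"
  unfolding spec_borel_def
proof (rule measurable_measure_of)
  show "{U. openin (spec_topology A) U} \<subseteq> Pow (Spec A)"
    using openin_subset[of "spec_topology A"] by (auto simp: topspace_spec_topology)
  show "f \<in> space N \<rightarrow> Spec A"
    using assms by (auto simp: continuous_map_def topspace_spec_topology)
  fix U assume "U \<in> {U. openin (spec_topology A) U}"
  then have "openin (top_of_set S) {x \<in> S. f x \<in> U}"
    using assms(1) by (simp add: continuous_map_def)
  then obtain T where "open T" "{x \<in> S. f x \<in> U} = S \<inter> T" by (auto simp: openin_open)
  moreover have "f -` U \<inter> space N = {x \<in> S. f x \<in> U}" using assms(2) by auto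
  ultimately show "f -` U \<inter> space N \<in> sets N" using assms(3) by simp
qed

lemma point_filter_measurable:
  "point_filter \<in> measurable (lebesgue_on (cube - {\<chi> i. 1} :: (real^'n) set)) (spec_borel Free)"
proof (rule measurable_spec_borel[OF continuous_map_point_filter])
  let ?S = "cube - {\<chi> i. 1} :: (real^'n) set"
  have "?S \<in> sets borel" using cube_borel by auto
  then show "?S \<inter> T \<in> sets (lebesgue_on ?S)" if "open T" for T
    using that by (auto simp: sets_restrict_space_iff)
qed simp

lemma exp_Delta:
  assumes "u \<in> (Delta :: (real^'n) set)"
  shows "(\<chi> i. exp (u $ i)) \<in> cube - {\<chi> i. 1}"
proof -
  have "u \<noteq> 0" using assms by (auto simp: Delta_def)
  then show ?thesis using assms by (auto simp: Delta_def cube_def vec_eq_iff)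
qed

lemma space_eta: "space (eta :: (real^'n) measure) = Delta"
  and sets_eta: "sets (eta :: (real^'n) measure) = sets (restrict_space borel Delta)"
  by (simp_all add: eta_def space_restrict_space sets_restrict_space affine_lborel_def Let_def)

lemma rho_measurable: "rho \<in> measurable (eta :: (real^'n) measure) (spec_borel Free)"
proof (rule measurable_spec_borel)
  have "continuous_on Delta (\<lambda>u::real^'n. \<chi> i. exp (u $ i))" by (intro continuous_intros)
  then have "continuous_map (top_of_set Delta) (top_of_set (cube - {\<chi> i. 1}))
      (\<lambda>u::real^'n. \<chi> i. exp (u $ i))"
    using exp_Delta by (auto simp: continuous_map_in_subtopology)
  then have "continuous_map (top_of_set Delta) (spec_topology Free)
      (point_filter \<circ> (\<lambda>u::real^'n. \<chi> i. exp (u $ i)))"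
    using continuous_map_point_filter by (rule continuous_map_compose)
  then show "continuous_map (top_of_set Delta) (spec_topology Free) (rho :: real^'n \<Rightarrow> _)"
    by (simp add: comp_def rho_def[abs_def] point_filter_def)
  show "space (eta :: (real^'n) measure) = Delta"
    by (rule space_eta)
  show "Delta \<inter> T \<in> sets (eta :: (real^'n) measure)" if "open T" for T
    using that Delta_borel by (auto simp: sets_eta sets_restrict_space)
qed

lemma emeasure_lambda_measure:
  assumes "A \<in> sets (spec_borel Free)"
  shows "emeasure lambda_measure A =
     emeasure lebesgue (point_filter -` A \<inter> (cube - {\<chi> i. 1} :: (real^'n) set))"
proof -
  have "cube - {\<chi> i. 1} \<in> sets (borel :: (real^'n) measure)" using cube_borel by auto
  then show ?thesis
    using assms
    by (simp add: lambda_measure_def emeasure_distr[OF point_filter_measurable]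
        emeasure_restrict_space)
qed

lemma emeasure_nu_measure:
  "A \<in> sets (spec_borel Free) \<Longrightarrow>
     emeasure nu_measure A = emeasure eta (rho -` A \<inter> (Delta :: (real^'n) set))"
  by (simp add: nu_measure_def emeasure_distr[OF rho_measurable] space_eta)

lemma orthonormal_basis_of:
  assumes "subspace S"
  shows "pairwise orthogonal (orthonormal_basis_of S)"
    and "\<forall>b\<in>orthonormal_basis_of S. norm b = 1"
    and "span (orthonormal_basis_of S) = S"
proof -
  have "\<exists>B. pairwise orthogonal B \<and> (\<forall>b\<in>B. norm b = 1) \<and> span B = S"
    using orthonormal_basis_subspace[OF assms] by metis
  from someI_ex[OF this] show "pairwise orthogonal (orthonormal_basis_of S)"
    "\<forall>b\<in>orthonormal_basis_of S. norm b = 1" "span (orthonormal_basis_of S) = S"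
    unfolding orthonormal_basis_of_def by blast+
qed

end

theory Submission imports Defs begin

text \<open>
  For \<open>t\<close> in the free algebra, \<open>t (exp (s u)) = t (exp u)\<^sup>s\<close>, so \<open>point_filter p\<close> only depends on the ray
  through \<open>ln p\<close>: it equals \<open>rho (ln p / - (\<Sum>i. ln p\<^sub>i))\<close>. Hence \<open>\<lambda>(A)\<close> is the Lebesgue measure of the
  \<open>p\<close> with \<open>ln p\<close> in the cone over \<open>E = \<rho>\<^sup>-\<^sup>1[A]\<close>, and this is a constant times the integral of
  \<open>exp (\<Sum>i. u\<^sub>i)\<close> over that cone. The exponential is constant on hyperplanes parallel to \<open>Delta\<close>, and the
  slices of the cone are scaled copies of \<open>E\<close>; so the integral is a constant times the
  \<open>(n-1)\<close>-dimensional measure of \<open>E\<close>. No constant has to be computed, since both measures are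
  normalized.

  Both changes of variables, \<open>p = exp u\<close> and the passage to an orthonormal basis adapted to the
  hyperplane, are obtained up to a constant from the uniqueness of translation-invariant measures.
  (The Jacobian formulas of the library need a well-ordered index type.)
\<close>

section \<open>Translation-invariant measures\<close>

text \<open>The classical uniqueness proof for Haar measure: the measure of
  \<open>A \<times> box 0 One\<close> under \<open>N \<times> lborel\<close> is computed by Fubini,
  and a shear of the product exchanges the roles of the two measures. Finiteness on balls makes
  \<open>N\<close> sigma-finite, as Fubini demands.\<close>

lemma translation_invariant_proportional_lborel:
  fixes N :: "'a::euclidean_space measure"
  assumes sets [measurable_cong]: "sets N = sets borel"
    and inv: "\<And>x. distr N borel ((+) x) = N"
    and fin: "\<And>r. emeasure N (cball 0 r) < \<infinity>"
    and A [measurable]: "A \<in> sets borel"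
  shows "emeasure N A = emeasure N (box 0 One) * emeasure lborel A"
proof -
  let ?B = "box 0 One :: 'a set"
  interpret N: sigma_finite_measure N
  proof
    show "\<exists>A. countable A \<and> A \<subseteq> sets N \<and> \<Union>A = space N \<and> (\<forall>a\<in>A. emeasure N a \<noteq> \<infinity>)"
      using fin sets_eq_imp_space_eq[OF sets]
      by (intro exI[of _ "range (\<lambda>k::nat. cball 0 (real k))"])
         (auto simp: sets less_top[symmetric] real_arch_simple)
  qed
  interpret pair_sigma_finite N "lborel :: 'a measure" ..
  have N_shift: "(\<integral>\<^sup>+x. f (y + x) \<partial>N) = (\<integral>\<^sup>+x. f x \<partial>N)"
    if [measurable]: "f \<in> borel_measurable borel" for f :: "'a \<Rightarrow> ennreal" and y
    by (subst (2) inv[of y, symmetric]) (simp add: nn_integral_distr sets)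
  have L_shift: "(\<integral>\<^sup>+y. f (y + x) \<partial>lborel) = (\<integral>\<^sup>+y. f y \<partial>lborel)"
    if [measurable]: "f \<in> borel_measurable borel" for f :: "'a \<Rightarrow> ennreal" and x
    by (subst (2) lborel_distr_plus[of x, symmetric]) (simp add: nn_integral_distr add.commute)
  have L_reflect: "(\<integral>\<^sup>+y. f (x - y) \<partial>lborel) = (\<integral>\<^sup>+y. f y \<partial>lborel)"
    if [measurable]: "f \<in> borel_measurable borel" for f :: "'a \<Rightarrow> ennreal" and x
    by (subst (2) lborel_affine[of "-1" x]) (simp_all add: nn_integral_distr nn_integral_density)
  have "emeasure N A * emeasure lborel ?B =
      (\<integral>\<^sup>+x. \<integral>\<^sup>+y. indicator A x * indicator ?B y \<partial>lborel \<partial>N)"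
    by (simp add: nn_integral_cmult nn_integral_multc sets)
  also have "\<dots> = (\<integral>\<^sup>+x. \<integral>\<^sup>+y. indicator A x * indicator ?B (y + x) \<partial>lborel \<partial>N)"
    by (intro nn_integral_cong L_shift[symmetric]) measurable
  also have "\<dots> = (\<integral>\<^sup>+y. \<integral>\<^sup>+x. indicator A x * indicator ?B (y + x) \<partial>N \<partial>lborel)"
    by (rule Fubini'[symmetric]) measurable
  \<comment> \<open>Writing \<open>x\<close> as \<open>y + x - y\<close> makes the integrand a
    function of \<open>y + x\<close>, so invariance of \<open>N\<close> applies. The set
    \<open>A\<close> is then tested at \<open>x - y\<close>, and the reflection of \<open>y\<close>
    below separates the variables again.\<close>
  also have "\<dots> = (\<integral>\<^sup>+y. \<integral>\<^sup>+x. indicator A (y + x - y) * indicator ?B (y + x) \<partial>N \<partial>lborel)"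
    by simp
  also have "\<dots> = (\<integral>\<^sup>+y. \<integral>\<^sup>+x. indicator A (x - y) * indicator ?B x \<partial>N \<partial>lborel)"
    by (intro nn_integral_cong N_shift) measurable
  also have "\<dots> = (\<integral>\<^sup>+x. \<integral>\<^sup>+y. indicator A (x - y) * indicator ?B x \<partial>lborel \<partial>N)"
    by (rule Fubini') measurable
  also have "\<dots> = (\<integral>\<^sup>+x. \<integral>\<^sup>+y. indicator A y * indicator ?B x \<partial>lborel \<partial>N)"
    by (intro nn_integral_cong L_reflect) measurable
  also have "\<dots> = emeasure N ?B * emeasure lborel A"
    by (simp add: nn_integral_cmult nn_integral_multc sets mult.commute)
  finally show ?thesis
    by (simp add: emeasure_lborel_box_eq inner_Basis)
qed

lemma translation_invariant_eq_density_lborel: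
  fixes N :: "'a::euclidean_space measure"
  assumes "sets N = sets borel" "\<And>x. distr N borel ((+) x) = N"
    and "\<And>r. emeasure N (cball 0 r) < \<infinity>"
  shows "N = density lborel (\<lambda>_. emeasure N (box 0 One))"
proof (rule measure_eqI)
  fix A assume "A \<in> sets N"
  then have A: "A \<in> sets borel" by (simp add: assms(1))
  then show "emeasure N A = emeasure (density lborel (\<lambda>_. emeasure N (box 0 One))) A"
    using translation_invariant_proportional_lborel[OF assms A]
    by (simp add: emeasure_density nn_integral_cmult_indicator)
qed (simp add: assms(1))

text \<open>By \<open>PiM_eqI\<close> it suffices to compare boxes, where each of the
  \<open>card I\<close> factors contributes one \<open>s\<close>. An abstract index set is used
  because coordinates will be indexed by the vectors of a basis; restricting the map to
  \<open>I\<close> keeps its values extensional.\<close>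

lemma PiM_lborel_affine:
  fixes t :: "'i \<Rightarrow> real"
  assumes I: "finite I" and s: "s > 0"
  shows "(\<Pi>\<^sub>M i\<in>I. lborel) = density
    (distr (\<Pi>\<^sub>M i\<in>I. lborel) (\<Pi>\<^sub>M i\<in>I. lborel) (\<lambda>c. \<lambda>i\<in>I. t i + s * c i)) (\<lambda>_. ennreal (s ^ card I))"
    (is "?P = density (distr ?P ?P ?f) _")
proof -
  interpret product_sigma_finite "\<lambda>_::'i. lborel :: real measure" ..
  have f [measurable]: "?f \<in> measurable ?P ?P" by measurable
  have "density (distr ?P ?P ?f) (\<lambda>_. ennreal (s ^ card I)) = ?P"
  proof (rule PiM_eqI[OF I])
    fix A :: "'i \<Rightarrow> real set"
    assume A: "\<And>i. i \<in> I \<Longrightarrow> A i \<in> sets lborel"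
    let ?A = "\<lambda>i. (\<lambda>x. t i + s * x) -` A i"
    have A': "?A i \<in> sets borel" if "i \<in> I" for i
      using measurable_sets[of "\<lambda>x. t i + s * x" borel borel "A i"] A[OF that] by simp
    have pre: "?f -` Pi\<^sub>E I A \<inter> space ?P = Pi\<^sub>E I ?A"
      by (auto simp: space_PiM PiE_iff)
    have scale: "emeasure lborel (A i) = ennreal s * emeasure lborel (?A i)" if "i \<in> I" for i
      using A[OF that] s
      by (subst lborel_real_affine[of s "t i"])
         (simp_all add: emeasure_density nn_integral_cmult emeasure_distr)
    have [measurable]: "Pi\<^sub>E I A \<in> sets ?P"
      using I A by (intro sets_PiM_I_finite) auto
    have "emeasure (density (distr ?P ?P ?f) (\<lambda>_. ennreal (s ^ card I))) (Pi\<^sub>E I A)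
        = ennreal (s ^ card I) * emeasure ?P (Pi\<^sub>E I ?A)"
      by (simp add: emeasure_density nn_integral_cmult emeasure_distr pre)
    also have "\<dots> = (\<Prod>i\<in>I. ennreal s * emeasure lborel (?A i))"
      using I A' s by (simp add: emeasure_PiM prod.distrib ennreal_power)
    also have "\<dots> = (\<Prod>i\<in>I. emeasure lborel (A i))"
      using scale by (intro prod.cong) auto
    finally show "emeasure (density (distr ?P ?P ?f) (\<lambda>_. ennreal (s ^ card I))) (Pi\<^sub>E I A)
        = (\<Prod>i\<in>I. emeasure lborel (A i))" .
  qed simp
  then show ?thesis ..
qed

text \<open>Serves twice: with \<open>s = 1\<close> for translations of \<open>span_measure\<close>,
  and with \<open>t = 0\<close> for dilations of the slices of a cone.\<close>

lemma nn_integral_PiM_lborel_affine: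
  fixes t :: "'i \<Rightarrow> real"
  assumes I: "finite I" and s: "s > 0"
    and f [measurable]: "f \<in> borel_measurable (\<Pi>\<^sub>M i\<in>I. lborel)"
  shows "(\<integral>\<^sup>+c. f c \<partial>(\<Pi>\<^sub>M i\<in>I. lborel)) =
     ennreal (s ^ card I) * (\<integral>\<^sup>+c. f (\<lambda>i\<in>I. t i + s * c i) \<partial>(\<Pi>\<^sub>M i\<in>I. lborel))"
  by (subst PiM_lborel_affine[OF I s, of t])
     (simp add: nn_integral_density nn_integral_distr nn_integral_cmult)

section \<open>The Haar measure of the positive orthant\<close>

definition log_vec :: "'a::euclidean_space \<Rightarrow> 'a" where
  "log_vec p = (\<Sum>j\<in>Basis. ln (p \<bullet> j) *\<^sub>R j)"

definition pos_orthant :: "'a::euclidean_space set" where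
  "pos_orthant = {p. \<forall>j\<in>Basis. 0 < p \<bullet> j}"

lemma log_vec_inner [simp]: "j \<in> Basis \<Longrightarrow> log_vec p \<bullet> j = ln (p \<bullet> j)"
  by (simp add: log_vec_def)

lemma log_vec_measurable [measurable]: "log_vec \<in> borel_measurable borel"
  unfolding log_vec_def[abs_def] by measurable

lemma pos_orthant_measurable [measurable]: "pos_orthant \<in> sets borel"
  unfolding pos_orthant_def by measurable

text \<open>On the orthant the exponential is the reciprocal of the product of the coordinates, so
  this is the Haar measure of the multiplicative group of positive vectors, written in logarithmic
  coordinates. The indicator discards points where \<open>ln\<close> has no meaningful
  value.\<close>

definition log_haar :: "'a::euclidean_space measure" where
  "log_haar = distr (density lborel
     (\<lambda>p. indicator pos_orthant p * ennreal (exp (- (\<Sum>j\<in>Basis. ln (p \<bullet> j)))))) borel log_vec"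

lemma sets_log_haar [measurable_cong]: "sets log_haar = sets borel"
  by (simp add: log_haar_def)

lemma nn_integral_log_haar:
  assumes [measurable]: "f \<in> borel_measurable borel"
  shows "(\<integral>\<^sup>+u. f u \<partial>log_haar) =
    (\<integral>\<^sup>+p. indicator pos_orthant p * ennreal (exp (- (\<Sum>j\<in>Basis. ln (p \<bullet> j)))) * f (log_vec p) \<partial>lborel)"
  unfolding log_haar_def by (simp add: nn_integral_distr nn_integral_density)

lemma emeasure_log_haar:
  assumes [measurable]: "A \<in> sets borel"
  shows "emeasure log_haar A = (\<integral>\<^sup>+p. indicator pos_orthant p *
    ennreal (exp (- (\<Sum>j\<in>Basis. ln (p \<bullet> j)))) * indicator A (log_vec p) \<partial>lborel)"
proof -
  have "emeasure log_haar A = (\<integral>\<^sup>+u. indicator A u \<partial>log_haar)"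
    by (rule nn_integral_indicator[symmetric]) (simp add: sets_log_haar)
  also have "\<dots> = (\<integral>\<^sup>+p. indicator pos_orthant p *
    ennreal (exp (- (\<Sum>j\<in>Basis. ln (p \<bullet> j)))) * indicator A (log_vec p) \<partial>lborel)"
    by (rule nn_integral_log_haar) measurable
  finally show ?thesis .
qed

text \<open>Translation by \<open>v\<close> in logarithmic coordinates is the dilation of the
  \<open>j\<close>-th coordinate by \<open>exp (v \<bullet> j)\<close>. The Jacobian of this
  dilation cancels against the change of the weight.\<close>

lemma log_haar_translate: "distr log_haar borel ((+) v) = (log_haar :: 'a::euclidean_space measure)"
proof (rule measure_eqI)
  fix A :: "'a set" assume "A \<in> sets (distr log_haar borel ((+) v))"
  then have [measurable]: "A \<in> sets borel" by simp
  \<comment> \<open>The summand \<open>0\<close> is the translation part in the pattern of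
    \<open>lborel_affine_euclidean\<close>.\<close>
  define T :: "'a \<Rightarrow> 'a" where "T = (\<lambda>x. 0 + (\<Sum>j\<in>Basis. (exp (v \<bullet> j) * (x \<bullet> j)) *\<^sub>R j))"
  let ?g = "\<lambda>p. indicator pos_orthant p * ennreal (exp (- (\<Sum>j\<in>Basis. ln (p \<bullet> j)))) * indicator A (log_vec p)"
  have T [measurable]: "T \<in> borel_measurable borel" unfolding T_def by measurable
  have T_inner: "j \<in> Basis \<Longrightarrow> T p \<bullet> j = exp (v \<bullet> j) * (p \<bullet> j)" for p j
    by (simp add: T_def)
  have lb: "lborel = density (distr lborel borel T) (\<lambda>_. (\<Prod>j\<in>Basis. \<bar>exp (v \<bullet> j)\<bar>))"
    unfolding T_def by (rule lborel_affine_euclidean) simp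
  have pos: "T p \<in> pos_orthant \<longleftrightarrow> p \<in> pos_orthant" for p
    by (auto simp: pos_orthant_def T_inner zero_less_mult_iff)
  have lnT: "ln (T p \<bullet> j) = v \<bullet> j + ln (p \<bullet> j)" if "p \<in> pos_orthant" "j \<in> Basis" for p j
  proof -
    have "0 < p \<bullet> j" using that by (simp add: pos_orthant_def)
    then show ?thesis unfolding T_inner[OF that(2)] by (subst ln_mult) simp_all
  qed
  have logT: "log_vec (T p) = v + log_vec p" if "p \<in> pos_orthant" for p
    by (rule euclidean_eqI) (simp add: lnT[OF that] inner_add_left)
  have sumT: "(\<Sum>j\<in>Basis. ln (T p \<bullet> j)) = (\<Sum>j\<in>Basis. v \<bullet> j) + (\<Sum>j\<in>Basis. ln (p \<bullet> j))"
    if "p \<in> pos_orthant" for p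
    unfolding sum.distrib[symmetric] by (rule sum.cong[OF refl lnT[OF that]])
  have "emeasure log_haar A = (\<integral>\<^sup>+p. ?g p \<partial>lborel)"
    by (rule emeasure_log_haar) measurable
  also have "\<dots> = (\<integral>\<^sup>+p. ennreal (\<Prod>j\<in>Basis. \<bar>exp (v \<bullet> j)\<bar>) * ?g (T p) \<partial>lborel)"
  proof -
    have "(\<integral>\<^sup>+p. ?g p \<partial>lborel) =
        (\<integral>\<^sup>+p. ennreal (\<Prod>j\<in>Basis. \<bar>exp (v \<bullet> j)\<bar>) * ?g p \<partial>distr lborel borel T)"
      by (rule trans[OF arg_cong[OF lb, of "\<lambda>M. nn_integral M ?g"] nn_integral_density]) measurable
    then show ?thesis
      by (rule trans) (rule nn_integral_distr, measurable)
  qed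
  also have "\<dots> = (\<integral>\<^sup>+p. indicator pos_orthant p * ennreal (exp (- (\<Sum>j\<in>Basis. ln (p \<bullet> j))))
      * indicator A (v + log_vec p) \<partial>lborel)"
  proof (rule nn_integral_cong)
    fix p :: 'a
    have "ennreal (\<Prod>j\<in>Basis. \<bar>exp (v \<bullet> j)\<bar>) * ennreal (exp (- (\<Sum>j\<in>Basis. ln (T p \<bullet> j))))
        = ennreal (exp (- (\<Sum>j\<in>Basis. ln (p \<bullet> j))))" if "p \<in> pos_orthant"
      by (simp add: sumT[OF that] exp_sum[symmetric] ennreal_mult'[symmetric] exp_add[symmetric])
    then show "ennreal (\<Prod>j\<in>Basis. \<bar>exp (v \<bullet> j)\<bar>) * ?g (T p) = indicator pos_orthant p
        * ennreal (exp (- (\<Sum>j\<in>Basis. ln (p \<bullet> j)))) * indicator A (v + log_vec p)"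
      by (cases "p \<in> pos_orthant") (simp_all add: pos logT mult.assoc[symmetric])
  qed
  also have "\<dots> = emeasure log_haar ((+) v -` A)"
    using measurable_sets[of "(+) v" borel borel A]
    by (subst emeasure_log_haar) (auto simp: indicator_def)
  also have "\<dots> = emeasure (distr log_haar borel ((+) v)) A"
    by (subst emeasure_distr) (simp_all add: sets_log_haar sets_eq_imp_space_eq[OF sets_log_haar])
  finally show "emeasure (distr log_haar borel ((+) v)) A = emeasure log_haar A" ..
qed (simp add: sets_log_haar)

text \<open>If all logarithms are at most \<open>r\<close> in absolute value, the point lies in a
  compact box of side bounds \<open>exp (- r)\<close> and \<open>exp r\<close>, and the weight is at
  most \<open>exp r\<close> to the power of the dimension.\<close>

lemma log_haar_cball_finite: "emeasure log_haar (cball (0 :: 'a::euclidean_space) r) < \<infinity>"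
proof -
  let ?K = "cbox (\<Sum>j\<in>Basis. exp (- r) *\<^sub>R j) (\<Sum>j\<in>Basis. exp r *\<^sub>R j) :: 'a set"
  have "emeasure log_haar (cball 0 r :: 'a set) = (\<integral>\<^sup>+p. indicator pos_orthant p *
      ennreal (exp (- (\<Sum>j\<in>Basis. ln (p \<bullet> j)))) * indicator (cball 0 r :: 'a set) (log_vec p) \<partial>lborel)"
    by (rule emeasure_log_haar) measurable
  also have "\<dots> \<le> (\<integral>\<^sup>+p. ennreal (exp (\<Sum>j\<in>(Basis::'a set). r)) * indicator ?K p \<partial>lborel)"
  proof (rule nn_integral_mono)
    fix p :: 'a
    have "p \<in> ?K \<and> exp (- (\<Sum>j\<in>Basis. ln (p \<bullet> j))) \<le> exp (\<Sum>j\<in>(Basis::'a set). r)"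
      if p: "p \<in> pos_orthant" "log_vec p \<in> cball 0 r"
    proof
      have *: "\<bar>ln (p \<bullet> j)\<bar> \<le> r" if "j \<in> Basis" for j
        using Basis_le_norm[OF that, of "log_vec p"] that p(2) by simp
      have "exp (- r) \<le> p \<bullet> j \<and> p \<bullet> j \<le> exp r" if "j \<in> Basis" for j
      proof -
        have "exp (- r) \<le> exp (ln (p \<bullet> j))" "exp (ln (p \<bullet> j)) \<le> exp r"
          using *[OF that] by auto
        moreover have "0 < p \<bullet> j" using p(1) that by (simp add: pos_orthant_def)
        ultimately show ?thesis by simp
      qed
      then show "p \<in> ?K" by (simp add: mem_box)
      have "(\<Sum>j\<in>Basis. - ln (p \<bullet> j)) \<le> (\<Sum>j\<in>(Basis::'a set). r)"
        using * by (intro sum_mono) (simp add: abs_le_iff)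
      then show "exp (- (\<Sum>j\<in>Basis. ln (p \<bullet> j))) \<le> exp (\<Sum>j\<in>(Basis::'a set). r)"
        by (simp add: sum_negf)
    qed
    then show "indicator pos_orthant p * ennreal (exp (- (\<Sum>j\<in>Basis. ln (p \<bullet> j))))
        * indicator (cball 0 r) (log_vec p)
      \<le> ennreal (exp (\<Sum>j\<in>(Basis::'a set). r)) * indicator ?K p"
      by (auto simp: indicator_def intro!: ennreal_leI)
  qed
  also have "\<dots> = ennreal (exp (\<Sum>j\<in>(Basis::'a set). r)) * emeasure lborel ?K"
    by (simp add: nn_integral_cmult_indicator)
  also have "\<dots> < \<infinity>"
    using emeasure_lborel_cbox_finite[of "\<Sum>j\<in>Basis. exp (- r) *\<^sub>R j" "\<Sum>j\<in>(Basis::'a set). exp r *\<^sub>R j"]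
    by (simp add: ennreal_mult_less_top less_top)
  finally show ?thesis .
qed

text \<open>The substitution \<open>p = exp u\<close>, up to a constant factor: multiplying by the
  weight of \<open>log_haar\<close> and by its inverse turns Lebesgue measure on the orthant into an
  integral against \<open>log_haar\<close>, which is a multiple of \<open>lborel\<close> by
  uniqueness.\<close>

lemma emeasure_log_vimage:
  fixes A :: "'a::euclidean_space set"
  assumes [measurable]: "A \<in> sets borel"
  shows "emeasure lborel {p \<in> pos_orthant. log_vec p \<in> A} = emeasure log_haar (box (0::'a) One) *
    (\<integral>\<^sup>+u. indicator A u * ennreal (exp (\<Sum>j\<in>Basis. u \<bullet> j)) \<partial>lborel)"
proof -
  let ?c = "emeasure log_haar (box (0::'a) One)"
  have "emeasure lborel {p \<in> pos_orthant. log_vec p \<in> A} =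
      (\<integral>\<^sup>+p. indicator pos_orthant p * ennreal (exp (- (\<Sum>j\<in>Basis. ln (p \<bullet> j)))) *
        (indicator A (log_vec p) * ennreal (exp (\<Sum>j\<in>Basis. log_vec p \<bullet> j))) \<partial>lborel)"
  proof (subst nn_integral_indicator[symmetric])
    show "(\<integral>\<^sup>+p. indicator {p \<in> pos_orthant. log_vec p \<in> A} p \<partial>lborel) =
      (\<integral>\<^sup>+p. indicator pos_orthant p * ennreal (exp (- (\<Sum>j\<in>Basis. ln (p \<bullet> j)))) *
        (indicator A (log_vec p) * ennreal (exp (\<Sum>j\<in>Basis. log_vec p \<bullet> j))) \<partial>lborel)"
      by (intro nn_integral_cong)
        (auto simp: indicator_def ennreal_mult'[symmetric] exp_add[symmetric])
  qed measurable
  also have "\<dots> = (\<integral>\<^sup>+u. indicator A u * ennreal (exp (\<Sum>j\<in>Basis. u \<bullet> j)) \<partial>log_haar)"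
    by (subst nn_integral_log_haar) simp_all
  also have "\<dots> = (\<integral>\<^sup>+u. indicator A u * ennreal (exp (\<Sum>j\<in>Basis. u \<bullet> j)) \<partial>density lborel (\<lambda>_. ?c))"
    by (subst translation_invariant_eq_density_lborel[OF sets_log_haar log_haar_translate
          log_haar_cball_finite]) simp
  also have "\<dots> = ?c * (\<integral>\<^sup>+u. indicator A u * ennreal (exp (\<Sum>j\<in>Basis. u \<bullet> j)) \<partial>lborel)"
    by (simp add: nn_integral_density nn_integral_cmult)
  finally show ?thesis .
qed

section \<open>Measures of cones\<close>

text \<open>The construction of \<open>affine_lborel\<close> with base point 0 and an explicit
  \<open>B\<close>. It will be applied to an orthonormal basis of the whole space that contains the
  unit normal of \<open>Delta\<close>.\<close>

definition span_measure :: "'a::euclidean_space set \<Rightarrow> 'a measure" where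
  "span_measure B = distr (\<Pi>\<^sub>M b\<in>B. lborel) borel (\<lambda>c. \<Sum>b\<in>B. c b *\<^sub>R b)"

lemma sets_span_measure [measurable_cong]: "sets (span_measure B) = sets borel"
  by (simp add: span_measure_def)

lemma linear_combination_measurable [measurable]:
  fixes B :: "'a::euclidean_space set"
  shows "(\<lambda>c. \<Sum>b\<in>B. c b *\<^sub>R b) \<in> borel_measurable (\<Pi>\<^sub>M b\<in>B. lborel)"
proof (intro borel_measurable_sum borel_measurable_scaleR borel_measurable_const)
  fix b assume "b \<in> B"
  then show "(\<lambda>c. c b) \<in> borel_measurable (\<Pi>\<^sub>M b\<in>B. lborel)"
    using measurable_component_singleton[of b B "\<lambda>_. lborel"] by simp
qed

lemma nn_integral_span_measure:
  assumes "f \<in> borel_measurable borel"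
  shows "(\<integral>\<^sup>+x. f x \<partial>span_measure B) = (\<integral>\<^sup>+c. f (\<Sum>b\<in>B. c b *\<^sub>R b) \<partial>(\<Pi>\<^sub>M b\<in>B. lborel))"
  using assms unfolding span_measure_def by (subst nn_integral_distr) simp_all

lemma emeasure_span_measure:
  assumes [measurable]: "A \<in> sets borel"
  shows "emeasure (span_measure B) A = (\<integral>\<^sup>+c. indicator A (\<Sum>b\<in>B. c b *\<^sub>R b) \<partial>(\<Pi>\<^sub>M b\<in>B. lborel))"
proof -
  have "emeasure (span_measure B) A = (\<integral>\<^sup>+x. indicator A x \<partial>span_measure B)"
    by (rule nn_integral_indicator[symmetric]) (simp add: sets_span_measure)
  also have "\<dots> = (\<integral>\<^sup>+c. indicator A (\<Sum>b\<in>B. c b *\<^sub>R b) \<partial>(\<Pi>\<^sub>M b\<in>B. lborel))"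
    by (rule nn_integral_span_measure) measurable
  finally show ?thesis .
qed

text \<open>Since \<open>B\<close> spans, \<open>x\<close> has coefficients \<open>t\<close>, and
  translation by \<open>x\<close> is induced by translating the coefficients by \<open>t\<close>,
  which preserves the product measure.\<close>

lemma span_measure_translate:
  assumes B: "finite B" "span B = UNIV"
  shows "distr (span_measure B) borel ((+) x) = span_measure B"
proof (rule measure_eqI)
  fix A assume "A \<in> sets (distr (span_measure B) borel ((+) x))"
  then have [measurable]: "A \<in> sets borel" by simp
  obtain t where t: "x = (\<Sum>b\<in>B. t b *\<^sub>R b)"
  proof -
    have "x \<in> range (\<lambda>u. \<Sum>b\<in>B. u b *\<^sub>R b)" using span_finite[OF B(1)] B(2) by simp
    then show thesis using that by blast
  qed
  have "emeasure (span_measure B) A =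
      (\<integral>\<^sup>+c. indicator A (\<Sum>b\<in>B. c b *\<^sub>R b) \<partial>(\<Pi>\<^sub>M b\<in>B. lborel))"
    by (rule emeasure_span_measure) measurable
  also have "\<dots> = (\<integral>\<^sup>+c. indicator A (\<Sum>b\<in>B. (\<lambda>b\<in>B. t b + 1 * c b) b *\<^sub>R b) \<partial>(\<Pi>\<^sub>M b\<in>B. lborel))"
    by (subst nn_integral_PiM_lborel_affine[OF B(1), of 1 _ t]) simp_all
  also have "\<dots> = (\<integral>\<^sup>+c. indicator A (x + (\<Sum>b\<in>B. c b *\<^sub>R b)) \<partial>(\<Pi>\<^sub>M b\<in>B. lborel))"
    by (simp add: t scaleR_add_left sum.distrib)
  also have "\<dots> = emeasure (span_measure B) ((+) x -` A)"
    using measurable_sets[of "(+) x" borel borel A]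
    by (subst emeasure_span_measure) (auto simp: indicator_def)
  also have "\<dots> = emeasure (distr (span_measure B) borel ((+) x)) A"
    by (subst emeasure_distr) (simp_all add: sets_span_measure sets_eq_imp_space_eq[OF sets_span_measure])
  finally show "emeasure (distr (span_measure B) borel ((+) x)) A = emeasure (span_measure B) A" ..
qed (simp add: sets_span_measure)

text \<open>Orthonormality makes each coefficient an inner product with a unit vector, so the
  coefficients of points of the ball stay in a bounded box.\<close>

lemma span_measure_cball_finite:
  assumes B: "finite B" "pairwise orthogonal B" "\<And>b. b \<in> B \<Longrightarrow> norm b = 1"
  shows "emeasure (span_measure B) (cball 0 r) < \<infinity>"
proof -
  let ?L = "\<lambda>c. \<Sum>b\<in>B. c b *\<^sub>R b"
  let ?P = "\<Pi>\<^sub>M b\<in>B. lborel :: real measure"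
  interpret product_sigma_finite "\<lambda>_::'a. lborel :: real measure" ..
  have coord: "?L c \<bullet> b = c b" if "b \<in> B" for c b
  proof -
    have "?L c \<bullet> b = (\<Sum>b'\<in>B. c b' * (b' \<bullet> b))" by (simp add: inner_sum_left)
    also have "\<dots> = (\<Sum>b'\<in>B. if b' = b then c b else 0)"
      using B that by (intro sum.cong) (auto simp: pairwise_def orthogonal_def norm_eq_1)
    finally show ?thesis using B(1) that by simp
  qed
  have "?L -` cball 0 r \<inter> space ?P \<subseteq> (\<Pi>\<^sub>E b\<in>B. {- r..r})"
  proof
    fix c assume c: "c \<in> ?L -` cball 0 r \<inter> space ?P"
    have "\<bar>c b\<bar> \<le> r" if "b \<in> B" for b
      using Cauchy_Schwarz_ineq2[of "?L c" b] coord[OF that] B(3)[OF that] c by simp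
    then show "c \<in> (\<Pi>\<^sub>E b\<in>B. {- r..r})"
      using c by (auto simp: space_PiM PiE_iff abs_le_iff minus_le_iff)
  qed
  then have "emeasure (span_measure B) (cball 0 r) \<le> emeasure ?P (\<Pi>\<^sub>E b\<in>B. {- r..r})"
    unfolding span_measure_def using B(1)
    by (subst emeasure_distr) (auto intro!: emeasure_mono sets_PiM_I_finite)
  also have "\<dots> = (\<Prod>b\<in>B. emeasure lborel {- r..r})"
    using B(1) by (intro emeasure_PiM) auto
  also have "\<dots> < \<infinity>"
    \<comment> \<open>For negative \<open>r\<close> the interval is empty, and the product is 0, or
      1 if \<open>B\<close> is empty.\<close>
    by (cases "- r \<le> r") (simp_all add: prod_ennreal less_top[symmetric] ennreal_power power_0_left)
  finally show ?thesis .
qed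

text \<open>Slicing along \<open>e\<close>: the slice of the cone at height \<open>y\<close> is the
  slice at height \<open>h\<close> dilated by \<open>y / h\<close>, and \<open>w\<close> is constant
  on it. Hence the integral is a radial factor, independent of \<open>E\<close>, times the measure
  of \<open>E\<close> in the hyperplane at height \<open>h\<close>.\<close>

lemma nn_integral_cone:
  fixes e :: "'a::euclidean_space"
  assumes B: "finite B" "\<And>b. b \<in> B \<Longrightarrow> b \<bullet> e = 0" and e: "norm e = 1" and h: "h > 0"
    and E [measurable]: "E \<in> sets borel" and w [measurable]: "w \<in> borel_measurable borel"
  shows "(\<integral>\<^sup>+x. indicator {x. x \<bullet> e > 0 \<and> (h / (x \<bullet> e)) *\<^sub>R x \<in> E} x * w (x \<bullet> e) \<partial>span_measure (insert e B)) =
    (\<integral>\<^sup>+y. indicator {0<..} y * w y * ennreal ((y / h) ^ card B) \<partial>lborel) *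
      emeasure (distr (\<Pi>\<^sub>M b\<in>B. lborel) borel (\<lambda>c. h *\<^sub>R e + (\<Sum>b\<in>B. c b *\<^sub>R b))) E"
proof -
  let ?P = "\<Pi>\<^sub>M b\<in>B. lborel :: real measure"
  let ?C = "{x. x \<bullet> e > 0 \<and> (h / (x \<bullet> e)) *\<^sub>R x \<in> E}"
  let ?L = "\<lambda>c. \<Sum>b\<in>B. c b *\<^sub>R b"
  let ?\<sigma> = "distr ?P borel (\<lambda>c. h *\<^sub>R e + ?L c)"
  interpret product_sigma_finite "\<lambda>_::'a. lborel :: real measure" ..
  have ee: "e \<bullet> e = 1" using e by (simp add: norm_eq_1)
  have eB: "e \<notin> B" using B(2)[of e] ee by auto
  have C [measurable]: "?C \<in> sets borel" by measurable
  have Le: "?L c \<bullet> e = 0" for c using B(2) by (simp add: inner_sum_left)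
  have upd: "(\<Sum>b\<in>insert e B. (c(e := y)) b *\<^sub>R b) = y *\<^sub>R e + ?L c" for c y
  proof -
    have "(\<Sum>b\<in>B. (c(e := y)) b *\<^sub>R b) = ?L c" using eB by (intro sum.cong) auto
    then show ?thesis using B(1) eB by (simp add: sum.insert)
  qed
  have inner: "(\<integral>\<^sup>+c. indicator ?C (y *\<^sub>R e + ?L c) * w y \<partial>?P) =
      indicator {0<..} y * w y * ennreal ((y / h) ^ card B) * emeasure ?\<sigma> E" for y
  proof (cases "y > 0")
    case True
    have "(\<integral>\<^sup>+c. indicator ?C (y *\<^sub>R e + ?L c) * w y \<partial>?P) = ennreal ((y / h) ^ card B) *
        (\<integral>\<^sup>+c. indicator ?C (y *\<^sub>R e + ?L (\<lambda>b\<in>B. 0 + y / h * c b)) * w y \<partial>?P)"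
      \<comment> \<open>Dilating the coefficients by \<open>y / h\<close> moves the slice at height
        \<open>y\<close> to height \<open>h\<close>.\<close>
      using True h by (intro nn_integral_PiM_lborel_affine[OF B(1)]) (simp, measurable)
    also have "(\<integral>\<^sup>+c. indicator ?C (y *\<^sub>R e + ?L (\<lambda>b\<in>B. 0 + y / h * c b)) * w y \<partial>?P) =
        (\<integral>\<^sup>+c. indicator E (h *\<^sub>R e + ?L c) * w y \<partial>?P)"
    proof (intro nn_integral_cong)
      fix c
      have L: "?L (\<lambda>b\<in>B. 0 + y / h * c b) = (y / h) *\<^sub>R ?L c"
        by (simp add: scaleR_sum_right)
      have "(y *\<^sub>R e + (y / h) *\<^sub>R ?L c) \<bullet> e = y"
        by (simp add: inner_add_left Le ee)
      moreover have "(h / y) *\<^sub>R (y *\<^sub>R e + (y / h) *\<^sub>R ?L c) = h *\<^sub>R e + ?L c"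
        using True h by (simp add: scaleR_add_right)
      ultimately have "y *\<^sub>R e + (y / h) *\<^sub>R ?L c \<in> ?C \<longleftrightarrow> h *\<^sub>R e + ?L c \<in> E"
        using True by simp
      then show "indicator ?C (y *\<^sub>R e + ?L (\<lambda>b\<in>B. 0 + y / h * c b)) * w y =
          indicator E (h *\<^sub>R e + ?L c) * w y"
        unfolding L by (simp add: indicator_def)
    qed
    also have "\<dots> = (\<integral>\<^sup>+c. indicator E (h *\<^sub>R e + ?L c) \<partial>?P) * w y"
      by (rule nn_integral_multc) measurable
    also have "(\<integral>\<^sup>+c. indicator E (h *\<^sub>R e + ?L c) \<partial>?P) = (\<integral>\<^sup>+x. indicator E x \<partial>?\<sigma>)"
      by (rule nn_integral_distr[symmetric]) measurable
    also have "\<dots> = emeasure ?\<sigma> E"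
      by (rule nn_integral_indicator) simp
    finally show ?thesis using True by (simp add: mult_ac)
  next
    case False
    then have "indicator ?C (y *\<^sub>R e + ?L c) = (0::ennreal)" for c
      by (simp add: inner_add_left Le ee)
    then show ?thesis using False by simp
  qed
  have "(\<integral>\<^sup>+x. indicator ?C x * w (x \<bullet> e) \<partial>span_measure (insert e B)) =
      (\<integral>\<^sup>+c. indicator ?C (\<Sum>b\<in>insert e B. c b *\<^sub>R b) * w ((\<Sum>b\<in>insert e B. c b *\<^sub>R b) \<bullet> e)
        \<partial>(\<Pi>\<^sub>M b\<in>insert e B. lborel))"
    by (rule nn_integral_span_measure) measurable
  \<comment> \<open>The coordinate along \<open>e\<close> becomes the outer integral, leaving the
    slices inside.\<close>
  also have "\<dots> = (\<integral>\<^sup>+y. \<integral>\<^sup>+c. indicator ?C (\<Sum>b\<in>insert e B. (c(e := y)) b *\<^sub>R b)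
      * w ((\<Sum>b\<in>insert e B. (c(e := y)) b *\<^sub>R b) \<bullet> e) \<partial>?P \<partial>lborel)"
    by (rule product_nn_integral_insert_rev[OF B(1) eB]) measurable
  also have "\<dots> = (\<integral>\<^sup>+y. \<integral>\<^sup>+c. indicator ?C (y *\<^sub>R e + ?L c) * w y \<partial>?P \<partial>lborel)"
    unfolding upd by (simp add: inner_add_left Le ee)
  also have "\<dots> = (\<integral>\<^sup>+y. indicator {0<..} y * w y * ennreal ((y / h) ^ card B) \<partial>lborel) * emeasure ?\<sigma> E"
    unfolding inner by (intro nn_integral_multc) measurable
  finally show ?thesis .
qed

section \<open>Radial projection to the simplex\<close>

text \<open>For positive \<open>s\<close>, the map \<open>r \<mapsto> r powr s\<close> is an
  endomorphism of \<open>M\<close>: it is multiplicative, fixes 1 and is increasing, so it commutes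
  with \<open>min 1 (b / a)\<close>. On the projections it is the scaling of the exponent, and
  induction carries this to all of \<open>Free\<close>.\<close>

lemma Free_homogeneous:
  fixes t :: "real^'n \<Rightarrow> real"
  assumes "t \<in> univ Free" "s > 0" "(\<chi> i. exp (u $ i)) \<in> cube"
  shows "t (\<chi> i. exp (s * u $ i)) = t (\<chi> i. exp (u $ i)) powr s"
proof -
  let ?p = "\<chi> i. exp (u $ i)" and ?q = "\<chi> i. exp (s * u $ i)"
  have q: "?q \<in> cube" using assms by (auto simp: cube_def mult_nonneg_nonpos)
  have "t \<in> generated (power_alg M cube) (range (\<lambda>i. \<lambda>p\<in>cube. p $ i))"
    using assms(1) by (simp add: Free_def)
  then show ?thesis
  proof induction
    case (gen a)
    then show ?case using assms(3) q by (auto simp: powr_def)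
  next
    case unit
    show ?case using assms(3) q by (simp add: power_alg_def M_def)
  next
    case (mul a b)
    have "a \<in> univ Free" "b \<in> univ Free" using mul by (auto simp: Free_def)
    then have "0 < a ?p" "0 < b ?p"
      using Free_continuous_range assms(3) by (fastforce simp: Pi_iff)+
    then show ?case using mul assms(3) q by (simp add: power_alg_def M_def powr_mult)
  next
    case (imp a b)
    have "a \<in> univ Free" "b \<in> univ Free" using imp by (auto simp: Free_def)
    then have pos: "0 < a ?p" "0 < b ?p"
      using Free_continuous_range assms(3) by (fastforce simp: Pi_iff)+
    have "min 1 (b ?p powr s / a ?p powr s) = min 1 (b ?p / a ?p) powr s"
    proof (cases "a ?p \<le> b ?p")
      case True
      then have "a ?p powr s \<le> b ?p powr s" using pos assms(2) by (intro powr_mono2) auto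
      then show ?thesis using True pos by (simp add: min_def)
    next
      case False
      then have "b ?p powr s < a ?p powr s" using pos assms(2) by (intro powr_less_mono2) auto
      then show ?thesis using False pos by (simp add: min_def powr_divide field_simps)
    qed
    then show ?case using imp assms(3) q by (simp add: power_alg_def M_def)
  qed
qed

text \<open>A positive power of a positive real is 1 only if the real is 1, so homogeneity makes
  \<open>point_filter\<close> constant along rays in logarithmic coordinates.\<close>

lemma point_filter_exp_scale:
  fixes u :: "real^'n"
  assumes s: "s > 0" and u: "(\<chi> i. exp (u $ i)) \<in> cube"
  shows "point_filter (\<chi> i. exp (s * u $ i)) = point_filter (\<chi> i. exp (u $ i))"
proof -
  have "t (\<chi> i. exp (s * u $ i)) = 1 \<longleftrightarrow> t (\<chi> i. exp (u $ i)) = 1" if "t \<in> univ Free" for t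
  proof -
    have "0 < t (\<chi> i. exp (u $ i))" using Free_continuous_range[OF that] u by (auto simp: Pi_iff)
    then show ?thesis using Free_homogeneous[OF that s u] s
      by (cases "t (\<chi> i. exp (u $ i)) = 1") simp_all
  qed
  then show ?thesis by (auto simp: point_filter_def)
qed

section \<open>From Euclidean bases to the coordinates of \<open>real^'n\<close>\<close>

lemma sum_Basis_vec: "(\<Sum>j\<in>Basis. f j) = (\<Sum>i\<in>UNIV. f (axis i (1::real) :: real^'n))"
proof -
  have *: "(Basis :: (real^'n) set) = range (\<lambda>i. axis i 1)" by (auto simp: Basis_vec_def)
  have "inj (\<lambda>i::'n. axis i (1::real))" by (simp add: inj_def axis_eq_axis)
  then show ?thesis unfolding * by (subst sum.reindex) (simp_all add: o_def)
qed

lemma One_vec: "(One :: real^'n) = (\<chi> i. 1)"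
proof -
  have "(One :: real^'n) $ i = 1" for i
    unfolding cart_eq_inner_axis by (simp add: axis_in_Basis_iff)
  then show ?thesis by (simp add: vec_eq_iff)
qed

lemma log_vec_nth [simp]: "log_vec (p :: real^'n) $ i = ln (p $ i)"
  using log_vec_inner[of "axis i 1" p] by (simp add: inner_axis)

lemma pos_orthant_vec: "(p :: real^'n) \<in> pos_orthant \<longleftrightarrow> (\<forall>i. 0 < p $ i)"
  by (auto simp: pos_orthant_def Basis_vec_def inner_axis)

text \<open>The set lies between the open and the closed unit box. This is the normalization of
  \<lambda>.\<close>

lemma emeasure_cube: "emeasure lborel (cube - {\<chi> i. 1} :: (real^'n) set) = 1"
proof (rule antisym)
  have "cube - {\<chi> i. 1} \<subseteq> (cbox 0 One :: (real^'n) set)"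
    by (auto simp: cube_def mem_box_cart One_vec less_imp_le)
  then have "emeasure lborel (cube - {\<chi> i. 1} :: (real^'n) set) \<le> emeasure lborel (cbox 0 One :: (real^'n) set)"
    by (rule emeasure_mono) simp
  then show "emeasure lborel (cube - {\<chi> i. 1} :: (real^'n) set) \<le> 1"
    by (simp add: emeasure_lborel_cbox_eq)
  have "(box 0 One :: (real^'n) set) \<subseteq> cube - {\<chi> i. 1}"
    by (auto simp: cube_def mem_box_cart One_vec less_imp_le)
  then have "emeasure lborel (box 0 One :: (real^'n) set) \<le> emeasure lborel (cube - {\<chi> i. 1} :: (real^'n) set)"
    using cube_borel by (intro emeasure_mono) auto
  then show "1 \<le> emeasure lborel (cube - {\<chi> i. 1} :: (real^'n) set)"
    by (simp add: emeasure_lborel_box_eq)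
qed

text \<open>For \<open>E\<close> inside \<open>Delta\<close> this is the union of the open rays from
  0 through \<open>E\<close>. Phrasing it by the radial projection makes measurability
  immediate.\<close>

definition ray_cone :: "(real^'n) set \<Rightarrow> (real^'n) set" where
  "ray_cone E = {u. (\<Sum>i\<in>UNIV. u $ i) < 0 \<and> (1 / - (\<Sum>i\<in>UNIV. u $ i)) *\<^sub>R u \<in> E}"

lemma rho_eq_point_filter: "rho u = point_filter (\<chi> i. exp (u $ i))"
  by (simp add: rho_def point_filter_def)

text \<open>The radial projection of \<open>log_vec p\<close> lies in \<open>Delta\<close> and has
  the same filter as \<open>p\<close>. Conversely, a ray that meets \<open>Delta\<close> has only
  nonpositive coordinates, so \<open>p\<close> is back in the cube.\<close>

lemma point_filter_vimage:
  "point_filter -` A \<inter> (cube - {\<chi> i. 1}) =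
    {p \<in> pos_orthant. log_vec p \<in> ray_cone (rho -` A \<inter> (Delta :: (real^'n) set))}"
  (is "?L = ?R")
proof -
  have key: "(1 / - (\<Sum>i\<in>UNIV. ln (p $ i))) *\<^sub>R log_vec p \<in> Delta"
      "rho ((1 / - (\<Sum>i\<in>UNIV. ln (p $ i))) *\<^sub>R log_vec p) = point_filter p"
      "(\<Sum>i\<in>UNIV. ln (p $ i)) < 0"
    if p: "p \<in> cube - {\<chi> i. 1}" for p :: "real^'n"
  proof -
    have pos: "0 < p $ i" "ln (p $ i) \<le> 0" for i using p by (auto simp: cube_def)
    \<comment> \<open>Excluding the point with all coordinates 1 makes the sum of logarithms
      strictly negative, so one may divide by it.\<close>
    obtain k where k: "p $ k \<noteq> 1" using p by (auto simp: vec_eq_iff)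
    then have "ln (p $ k) < 0" using p pos(1)[of k] by (auto simp: cube_def le_less)
    then have "0 < (\<Sum>i\<in>UNIV. - ln (p $ i))" using pos(2) by (intro sum_pos2[of _ k]) auto
    then show neg: "(\<Sum>i\<in>UNIV. ln (p $ i)) < 0" by (simp add: sum_negf)
    then show "(1 / - (\<Sum>i\<in>UNIV. ln (p $ i))) *\<^sub>R log_vec p \<in> Delta"
      using pos(2) by (auto simp: Delta_def sum_divide_distrib[symmetric] sum_negf divide_nonpos_neg
          intro: divide_nonpos_neg)
    have id: "(\<chi> i. exp (log_vec p $ i)) = p" using pos by (simp add: vec_eq_iff)
    have "rho ((1 / - (\<Sum>i\<in>UNIV. ln (p $ i))) *\<^sub>R log_vec p) =
        point_filter (\<chi> i. exp ((1 / - (\<Sum>i\<in>UNIV. ln (p $ i))) * log_vec p $ i))"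
      unfolding rho_eq_point_filter by (simp only: vector_scaleR_component real_scaleR_def)
    also have "\<dots> = point_filter (\<chi> i. exp (log_vec p $ i))"
      using neg p id by (intro point_filter_exp_scale) auto
    finally show "rho ((1 / - (\<Sum>i\<in>UNIV. ln (p $ i))) *\<^sub>R log_vec p) = point_filter p"
      by (simp only: id)
  qed
  have in_cube: "p \<in> cube - {\<chi> i. 1}"
    if pos: "p \<in> pos_orthant" and neg: "(\<Sum>i\<in>UNIV. ln (p $ i)) < 0"
      and D: "(1 / - (\<Sum>i\<in>UNIV. ln (p $ i))) *\<^sub>R log_vec p \<in> Delta" for p :: "real^'n"
  proof -
    have "ln (p $ i) \<le> 0" for i
    proof -
      have "ln (p $ i) / - (\<Sum>i\<in>UNIV. ln (p $ i)) \<le> 0" using D by (auto simp: Delta_def)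
      then show ?thesis using neg by (simp add: divide_le_0_iff zero_le_divide_iff)
    qed
    then have "p \<in> cube" using pos by (auto simp: cube_def pos_orthant_vec)
    moreover have "p \<noteq> (\<chi> i. 1)" using neg by auto
    ultimately show ?thesis by simp
  qed
  show ?thesis
  proof (intro set_eqI iffI)
    fix p assume "p \<in> ?L"
    then show "p \<in> ?R" using key[of p] by (auto simp: ray_cone_def pos_orthant_vec cube_def)
  next
    fix p assume "p \<in> ?R"
    then have "p \<in> pos_orthant" "(\<Sum>i\<in>UNIV. ln (p $ i)) < 0"
        "(1 / - (\<Sum>i\<in>UNIV. ln (p $ i))) *\<^sub>R log_vec p \<in> rho -` A \<inter> Delta"
      by (simp_all add: ray_cone_def)
    then show "p \<in> ?L" using key[of p] in_cube[of p] by auto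
  qed
qed

lemma ray_cone_measurable:
  assumes [measurable]: "E \<in> sets borel"
  shows "ray_cone E \<in> sets borel"
  unfolding ray_cone_def by measurable

section \<open>Cones over the simplex in an adapted orthonormal basis\<close>

lemma span_insert_normal:
  fixes B :: "'a::euclidean_space set"
  assumes "span B = {x. x \<bullet> e = 0}" "norm e = 1"
  shows "span (insert e B) = UNIV"
proof -
  have "x \<in> span (insert e B)" for x
  proof -
    have "(x - (x \<bullet> e) *\<^sub>R e) \<bullet> e = 0"
      using assms(2) by (simp add: inner_diff_left norm_eq_1)
    then have "x - (x \<bullet> e) *\<^sub>R e \<in> span B" using assms(1) by simp
    then show ?thesis unfolding span_insert by blast
  qed
  then show ?thesis by blast
qed

text \<open>Neither constant depends on \<open>E\<close>: \<open>c\<close> is the density of the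
  adapted coordinate measure with respect to \<open>lborel\<close>, and \<open>K\<close> is the
  radial integral. Only \<open>c\<close> is shown to be nonzero and finite here; the normalization
  takes care of \<open>K\<close> later.\<close>

lemma ray_cone_affine_lborel:
  defines "\<sigma> \<equiv> affine_lborel (\<chi> i. - 1 / real CARD('n)) {v :: real^'n. (\<Sum>i\<in>UNIV. v $ i) = 0}"
  obtains c K where "c \<noteq> 0" "c \<noteq> (\<infinity> :: ennreal)"
    "\<And>E. E \<in> sets borel \<Longrightarrow>
      c * (\<integral>\<^sup>+u. indicator (ray_cone E) u * ennreal (exp (\<Sum>j\<in>Basis. u \<bullet> j)) \<partial>lborel) = K * emeasure \<sigma> E"
proof -
  let ?n = "real CARD('n)"
  define S where "S = {v :: real^'n. (\<Sum>i\<in>UNIV. v $ i) = 0}"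
  \<comment> \<open>This is the very basis selected inside \<open>affine_lborel\<close>, so \<sigma>
    unfolds to an explicit pushforward.\<close>
  define B where "B = orthonormal_basis_of S"
  \<comment> \<open>The unit normal of \<open>Delta\<close> pointing towards it.
    \<open>Delta\<close> has height \<open>1 / sqrt n\<close> along \<open>e\<close>, with
    \<open>n\<close> the dimension, and the coordinate sum of \<open>x\<close> is
    \<open>- sqrt n * (x \<bullet> e)\<close>, which explains \<open>w\<close>.\<close>
  define e :: "real^'n" where "e = (\<chi> i. - 1 / sqrt ?n)"
  define N where "N = span_measure (insert e B)"
  define w :: "real \<Rightarrow> ennreal" where "w = (\<lambda>y. ennreal (exp (- sqrt ?n * y)))"
  have inner_e: "x \<bullet> e = - (\<Sum>i\<in>UNIV. x $ i) / sqrt ?n" for x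
    by (simp add: e_def inner_vec_def sum_divide_distrib sum_negf)
  have norm_e: "norm e = 1"
    by (simp add: norm_eq_1 inner_e) (simp add: e_def real_div_sqrt)
  have S_eq: "S = {x. x \<bullet> e = 0}" by (simp add: S_def inner_e)
  have "subspace S" unfolding S_eq
    using subspace_orthogonal_to_vector[of e] by (simp add: orthogonal_def inner_commute)
  from orthonormal_basis_of[OF this]
  have B: "pairwise orthogonal B" "\<forall>b\<in>B. norm b = 1" "span B = S"
    by (simp_all add: B_def)
  have "0 \<notin> B" using B(2) by force
  then have finB: "finite B" using pairwise_orthogonal_independent[OF B(1)] independent_imp_finite by blast
  have Be: "b \<bullet> e = 0" if "b \<in> B" for b
    using span_base[OF that] B(3) S_eq by auto
  have span: "span (insert e B) = UNIV"
    using B(3) S_eq norm_e by (intro span_insert_normal) auto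
  have orth: "pairwise orthogonal (insert e B)"
    using B(1) Be by (auto simp: pairwise_insert orthogonal_def inner_commute)
  have setsN: "sets N = sets borel" by (simp add: N_def sets_span_measure)
  have N_inv: "distr N borel ((+) x) = N" for x
    unfolding N_def using finB span by (intro span_measure_translate) auto
  have N_fin: "emeasure N (cball 0 r) < \<infinity>" for r
    unfolding N_def using finB orth B(2) norm_e by (intro span_measure_cball_finite) auto
  define c where "c = emeasure N (box 0 One)"
  have N_eq: "N = density lborel (\<lambda>_. c)"
    unfolding c_def by (rule translation_invariant_eq_density_lborel[OF setsN N_inv N_fin])
  show thesis
  proof (rule that)
    obtain r where "\<forall>x\<in>box (0 :: real^'n) One. norm x \<le> r"
      using bounded_box unfolding bounded_iff by blast
    then have "box (0 :: real^'n) One \<subseteq> cball 0 r" by auto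
    then have "c \<le> emeasure N (cball 0 r)"
      unfolding c_def by (rule emeasure_mono) (simp add: setsN)
    then show "c \<noteq> \<infinity>" using N_fin[of r] by (auto simp: top_unique)
    show "c \<noteq> 0"
    proof
      \<comment> \<open>Then \<open>N\<close> would vanish, whereas its total mass is a product of
        factors \<open>emeasure lborel UNIV\<close>, all nonzero.\<close>
      assume "c = 0"
      then have "emeasure N UNIV = 0" by (simp add: N_eq emeasure_density)
      moreover have "emeasure N UNIV = emeasure (\<Pi>\<^sub>M b\<in>insert e B. lborel :: real measure) (\<Pi>\<^sub>E b\<in>insert e B. UNIV)"
        by (simp add: N_def span_measure_def emeasure_distr space_PiM)
      moreover have "\<dots> = (\<Prod>b\<in>insert e B. emeasure lborel (UNIV :: real set))"
      proof -
        interpret product_sigma_finite "\<lambda>_::real^'n. lborel :: real measure" ..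
        show ?thesis using finB by (intro emeasure_PiM) auto
      qed
      ultimately show False using finB by (simp add: prod_zero_iff)
    qed
    fix E :: "(real^'n) set" assume E [measurable]: "E \<in> sets borel"
    have sq: "sqrt ?n > 0" by simp
    have sumx: "(\<Sum>i\<in>UNIV. x $ i) = - sqrt ?n * (x \<bullet> e)" for x :: "real^'n"
      by (simp add: inner_e)
    have cone: "ray_cone E = {x. x \<bullet> e > 0 \<and> ((1 / sqrt ?n) / (x \<bullet> e)) *\<^sub>R x \<in> E}"
      unfolding ray_cone_def sumx by (auto simp: mult_less_0_iff zero_less_mult_iff)
    \<comment> \<open>The foot of the normal at height \<open>1 / sqrt n\<close> is the base point
      used in \<open>eta\<close>.\<close>
    have base: "(1 / sqrt ?n) *\<^sub>R e = (\<chi> i. - 1 / ?n)"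
      by (simp add: e_def vec_eq_iff)
    have \<sigma>: "\<sigma> = distr (\<Pi>\<^sub>M b\<in>B. lborel) borel (\<lambda>c. (1 / sqrt ?n) *\<^sub>R e + (\<Sum>b\<in>B. c b *\<^sub>R b))"
      unfolding \<sigma>_def affine_lborel_def Let_def S_def[symmetric] B_def[symmetric] base ..
    have [measurable]: "ray_cone E \<in> sets borel" by (rule ray_cone_measurable[OF E])
    have [measurable]: "w \<in> borel_measurable borel" unfolding w_def by measurable
    have "c * (\<integral>\<^sup>+u. indicator (ray_cone E) u * ennreal (exp (\<Sum>j\<in>Basis. u \<bullet> j)) \<partial>lborel) =
        (\<integral>\<^sup>+u. c * (indicator (ray_cone E) u * ennreal (exp (\<Sum>j\<in>Basis. u \<bullet> j))) \<partial>lborel)"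
      by (rule nn_integral_cmult[symmetric]) measurable
    also have "\<dots> = (\<integral>\<^sup>+u. indicator (ray_cone E) u * ennreal (exp (\<Sum>j\<in>Basis. u \<bullet> j)) \<partial>N)"
      unfolding N_eq by (rule nn_integral_density[symmetric]) measurable
    also have "\<dots> = (\<integral>\<^sup>+u. indicator (ray_cone E) u * w (u \<bullet> e) \<partial>N)"
      by (simp only: w_def sum_Basis_vec cart_eq_inner_axis[symmetric] sumx)
    also have "\<dots> = (\<integral>\<^sup>+y. indicator {0<..} y * w y * ennreal ((y / (1 / sqrt ?n)) ^ card B) \<partial>lborel) *
        emeasure \<sigma> E"
      unfolding N_def cone \<sigma> using sq by (intro nn_integral_cone finB Be norm_e) auto
    finally show "c * (\<integral>\<^sup>+u. indicator (ray_cone E) u * ennreal (exp (\<Sum>j\<in>Basis. u \<bullet> j)) \<partial>lborel) =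
        (\<integral>\<^sup>+y. indicator {0<..} y * w y * ennreal ((y / (1 / sqrt ?n)) ^ card B) \<partial>lborel) * emeasure \<sigma> E" .
  qed
qed

section \<open>Comparison of the two normalized measures\<close>

lemma emeasure_restrict_uniform_measure:
  assumes "D \<in> sets N" "E \<in> sets N" "E \<subseteq> D"
  shows "emeasure (restrict_space (uniform_measure N D) D) E = emeasure N E / emeasure N D"
  using assms sets.sets_into_space[OF assms(1)]
  by (simp add: emeasure_restrict_space emeasure_uniform_measure Int_absorb1 Int_absorb2)

theorem theorem4p2: "(nu_measure :: (real^'n \<Rightarrow> real) set measure) = lambda_measure"
proof (rule measure_eqI)
  show "sets (nu_measure :: (real^'n \<Rightarrow> real) set measure) = sets lambda_measure"
    by (simp add: nu_measure_def lambda_measure_def)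
next
  let ?\<sigma> = "affine_lborel (\<chi> i. - 1 / real CARD('n)) {v :: real^'n. (\<Sum>i\<in>UNIV. v $ i) = 0}"
  have \<sigma>_sets: "sets ?\<sigma> = sets borel" by (simp add: affine_lborel_def Let_def)
  obtain c K where c: "c \<noteq> 0" "c \<noteq> \<infinity>" and cK: "\<And>E. E \<in> sets borel \<Longrightarrow>
      c * (\<integral>\<^sup>+u. indicator (ray_cone E) u * ennreal (exp (\<Sum>j\<in>Basis. u \<bullet> j)) \<partial>lborel) = K * emeasure ?\<sigma> E"
    using ray_cone_affine_lborel by blast
  define d where "d = emeasure log_haar (box (0::real^'n) One)"
  define L where "L A = emeasure lborel (point_filter -` A \<inter> (cube - {\<chi> i. 1} :: (real^'n) set))" for A
  \<comment> \<open>Only a Borel preimage under \<open>rho\<close> is required of \<open>A\<close>,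
    so that \<open>UNIV\<close> is admissible next.\<close>
  have c_L: "c * L A = d * K * emeasure ?\<sigma> (rho -` A \<inter> Delta)"
    if E: "rho -` A \<inter> (Delta :: (real^'n) set) \<in> sets borel" for A
    unfolding L_def point_filter_vimage emeasure_log_vimage[OF ray_cone_measurable[OF E]] d_def[symmetric]
    by (simp only: mult.left_commute[of c] cK[OF E] mult.assoc)
  \<comment> \<open>For \<open>UNIV\<close> the left side is \<open>c * 1\<close>. As
    \<open>c\<close> is nonzero and finite, so are both factors \<open>d * K\<close> and the measure
    of \<open>Delta\<close>, and everything can be cancelled.\<close>
  have c_eq: "c = d * K * emeasure ?\<sigma> Delta"
    using c_L[of UNIV] Delta_borel by (simp add: L_def emeasure_cube)
  then have K: "d * K \<noteq> 0" "d * K \<noteq> \<infinity>" and D: "emeasure ?\<sigma> Delta \<noteq> 0" "emeasure ?\<sigma> Delta \<noteq> \<infinity>"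
    using c by (auto simp: ennreal_mult_eq_top_iff)
  fix A :: "(real^'n \<Rightarrow> real) set set" assume "A \<in> sets nu_measure"
  then have A: "A \<in> sets (spec_borel Free)" by (simp add: nu_measure_def)
  let ?E = "rho -` A \<inter> (Delta :: (real^'n) set)"
  have "?E \<in> sets (restrict_space borel Delta)"
    using measurable_sets[OF rho_measurable A] by (simp add: space_eta sets_eta)
  then have E: "?E \<in> sets borel"
    using Delta_borel by (auto simp: sets_restrict_space)
  have "d * K * (L A * emeasure ?\<sigma> Delta) = L A * c"
    using c_eq by (simp add: mult_ac)
  also have "\<dots> = d * K * emeasure ?\<sigma> ?E"
    using c_L[OF E] by (simp add: mult_ac)
  finally have "L A * emeasure ?\<sigma> Delta = emeasure ?\<sigma> ?E"
    using K by (simp add: ennreal_mult_cancel_left)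
  then have "L A = emeasure ?\<sigma> ?E / emeasure ?\<sigma> Delta"
    using mult_divide_eq_ennreal[OF D(1), of "L A"] D(2) by simp
  moreover have "emeasure nu_measure A = emeasure ?\<sigma> ?E / emeasure ?\<sigma> Delta"
    unfolding emeasure_nu_measure[OF A] eta_def using E Delta_borel
    by (intro emeasure_restrict_uniform_measure) (auto simp only: \<sigma>_sets)
  moreover have "emeasure lambda_measure A = L A"
  proof -
    \<comment> \<open>On Borel sets \<open>lebesgue\<close> agrees with \<open>lborel\<close>, which
      identifies \<lambda> with \<open>L\<close>.\<close>
    have "point_filter -` A \<inter> (cube - {\<chi> i. 1} :: (real^'n) set) \<in> sets borel"
      unfolding point_filter_vimage using ray_cone_measurable[OF E] by measurable
    then show ?thesis by (simp add: emeasure_lambda_measure[OF A] L_def)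
  qed
  ultimately show "emeasure nu_measure A = emeasure lambda_measure A" by simp
qed

end
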